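(* Let $G$ be a multigraph with $n\ge 2$ vertices and $m\ge 1$ edges. (i) If $\frac{m}{n-1}<3$, then $$C(G)<\tfrac34\,\Delta(G)\cdot(\sqrt[3]{3})^m.$$ (ii) If $\frac{m}{n-1}\ge 3$, and $s=\left\lfloor\frac{m}{n-1}\right\rfloor$, $\alpha=\frac{m}{n-1}-s$, then $$C(G)<\tfrac34\,\Delta(G)\left(s^{1-\alpha}(s+1)^{\alpha}\right)^{n-1}=\tfrac34\,\Delta(G)\left(\left(s^{1-\alpha}(s+1)^{\alpha}\right)^{\frac{1}{s+\alpha}}\right)^m.$$
   Context: Multigraphs are finite, may have parallel edges, and have no loops. The degree of a vertex is the number of edges incident to it (parallel edges counted separately), and $\Delta(G)$ is the maximum degree. A cycle in a multigraph $G$ is a set of $k\ge 2$ distinct vertices and $k$ distinct edges $\{v_1,e_1,v_2,e_2,\dots,v_k,e_k\}$ such that $e_i$ joins $v_i$ and $v_{i+1}$ for $1\le i<k$ and $e_k$ joins $v_k$ and $v_1$ (so two parallel edges together with their two endpoints form a cycle; choice of starting point and direction is irrelevant). $C(G)$ denotes the number of cycles in $G$. *)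

theory Defs
  imports Complex_Main
begin

record ('v, 'e) multigraph_data =
  verts :: "'v set"
  edges :: "'e set"
  ends :: "'e \<Rightarrow> 'v set"

text \<open>
  Edges are named objects, so different edges may have the same endpoint set (parallel edges).
  Requiring exactly two endpoints excludes loops.
\<close>

locale multigraph =
  fixes G :: "('v, 'e) multigraph_data"
  assumes finite_verts: "finite (verts G)"
    and finite_edges: "finite (edges G)"
    and ends_subset: "e \<in> edges G \<Longrightarrow> ends G e \<subseteq> verts G"
    and card_ends: "e \<in> edges G \<Longrightarrow> card (ends G e) = 2"

definition degree :: "('v, 'e) multigraph_data \<Rightarrow> 'v \<Rightarrow> nat" where
  "degree G v = card {e \<in> edges G. v \<in> ends G e}"

definition max_degree :: "('v, 'e) multigraph_data \<Rightarrow> nat" where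
  "max_degree G = Max (degree G ` verts G)"

definition joins :: "('v, 'e) multigraph_data \<Rightarrow> 'e \<Rightarrow> 'v \<Rightarrow> 'v \<Rightarrow> bool" where
  "joins G e u v \<longleftrightarrow> e \<in> edges G \<and> ends G e = {u, v}"

definition cyclic_sequence :: "('v, 'e) multigraph_data \<Rightarrow> 'v list \<Rightarrow> 'e list \<Rightarrow> bool" where
  "cyclic_sequence G vs es \<longleftrightarrow>
     2 \<le> length vs \<and> length es = length vs \<and>
     distinct vs \<and> distinct es \<and> set vs \<subseteq> verts G \<and>
     (\<forall>i < length vs. joins G (es ! i) (vs ! i) (vs ! (Suc i mod length vs)))"

text \<open>
  A cycle is the set of its vertices together with the set of its edges; passing to sets forgets
  the starting point and the direction of the sequence.
\<close>

definition cycles :: "('v, 'e) multigraph_data \<Rightarrow> ('v set \<times> 'e set) set" where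
  "cycles G = {(set vs, set es) | vs es. cyclic_sequence G vs es}"

definition num_cycles :: "('v, 'e) multigraph_data \<Rightarrow> nat" where
  "num_cycles G = card (cycles G)"

lemma (in multigraph) finite_cycles: "finite (cycles G)"
proof (rule finite_subset)
  show "cycles G \<subseteq> Pow (verts G) \<times> Pow (edges G)"
    by (auto simp: cycles_def cyclic_sequence_def joins_def in_set_conv_nth)
  show "finite (Pow (verts G) \<times> Pow (edges G))"
    using finite_verts finite_edges by simp
qed

end

theory Submission
  imports Defs
begin

text \<open>
  Growing a path towards a fixed vertex, leaving a vertex that meets \<open>d\<close> of the surviving edges
  allows \<open>d\<close> choices and then kills these \<open>d\<close> edges, since the path never returns. So the number
  of paths is at most a product of at most \<open>n - 1\<close> integers whose sum is at most \<open>m\<close>. If \<open>A\<close>, \<open>B \<ge> 1\<close>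
  satisfy \<open>d \<le> A * B ^ d\<close> for all naturals \<open>d\<close>, then this product is at most \<open>A ^ (n - 1) * B ^ m\<close>.
  Every cycle through a vertex \<open>v\<close> has two traversals starting at \<open>v\<close>, hence there are at most
  \<open>deg v / 2 * A ^ (n - 1) * B ^ (m - 1)\<close> of them, and deleting \<open>v\<close> gives an induction on \<open>n\<close>.
  Part (i) is the choice \<open>A = 1\<close>, \<open>B = root 3 3\<close>; part (ii) is \<open>B = (s + 1) / s\<close>, \<open>A = s / B ^ s\<close>, for
  which \<open>d \<le> A * B ^ d\<close> is an equality at \<open>d = s\<close> and \<open>d = s + 1\<close>.
\<close>

section \<open>Counting paths towards a fixed vertex\<close>

text \<open>
  Paths run from \<open>x\<close> to \<open>y\<close>. Discarding all edges at \<open>x\<close> makes a return to \<open>x\<close> impossible, so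
  no distinctness of the vertices has to be imposed.
\<close>

fun path_to :: "('e \<Rightarrow> 'v set) \<Rightarrow> 'v \<Rightarrow> 'e set \<Rightarrow> 'v \<Rightarrow> 'e list \<Rightarrow> bool" where
  "path_to r y E x [] \<longleftrightarrow> x = y"
| "path_to r y E x (e # es) \<longleftrightarrow> x \<noteq> y \<and> e \<in> E \<and>
     (\<exists>z. r e = {x, z} \<and> path_to r y {f \<in> E. x \<notin> r f} z es)"

lemma card_2_otherE:
  assumes "card S = 2" "x \<in> S"
  obtains z where "S = {x, z}" "z \<noteq> x"
proof -
  have "card (S - {x}) = 1" using assms by simp
  then obtain z where "S - {x} = {z}" by (rule card_1_singletonE)
  then show ?thesis using assms that[of z] by blast
qed

text \<open>Lists are sorted by their first entry, with at most \<open>M\<close> tails for each.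
  Finiteness of the tail sets is a separate assumption because \<open>card\<close> of an infinite
  set is 0, so a bound on \<open>card\<close> alone would not exclude infinity.\<close>

lemma card_Cons_le:
  fixes M :: real
  assumes "finite I" and "\<And>e. e \<in> I \<Longrightarrow> finite {es. P e es}"
    and "\<And>e. e \<in> I \<Longrightarrow> real (card {es. P e es}) \<le> M"
  shows "finite {e # es | e es. e \<in> I \<and> P e es}"
    and "real (card {e # es | e es. e \<in> I \<and> P e es}) \<le> real (card I) * M"
proof -
  have eq: "{e # es | e es. e \<in> I \<and> P e es} = (\<Union>e\<in>I. Cons e ` {es. P e es})"
    by auto
  show "finite {e # es | e es. e \<in> I \<and> P e es}"
    unfolding eq using assms by auto
  have "card (\<Union>e\<in>I. Cons e ` {es. P e es}) \<le> (\<Sum>e\<in>I. card (Cons e ` {es. P e es}))"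
    by (rule card_UN_le[OF assms(1)])
  also have "\<dots> = (\<Sum>e\<in>I. card {es. P e es})"
    by (intro sum.cong refl card_image) (auto simp: inj_on_def)
  finally have "real (card (\<Union>e\<in>I. Cons e ` {es. P e es})) \<le> (\<Sum>e\<in>I. real (card {es. P e es}))"
    by (simp flip: of_nat_sum)
  also have "\<dots> \<le> real (card I) * M"
    using assms(3) by (rule sum_bounded_above)
  finally show "real (card {e # es | e es. e \<in> I \<and> P e es}) \<le> real (card I) * M"
    unfolding eq .
qed

text \<open>Each departure from a vertex other than \<open>y\<close> is charged one factor
  \<open>A\<close>, and each edge killed there one factor \<open>B\<close>; hence the exponents
  \<open>card (V - {y})\<close> and \<open>card E\<close>. The induction removes the current vertex
  \<open>x\<close> from \<open>V\<close> and its edges from \<open>E\<close>, while \<open>y\<close>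
  stays fixed.\<close>

lemma path_count:
  fixes A B :: real
  assumes "1 \<le> A" "1 \<le> B" and dAB: "\<And>d::nat. real d \<le> A * B ^ d"
    and "finite V" "finite E" and "\<And>e. e \<in> E \<Longrightarrow> r e \<subseteq> V \<and> card (r e) = 2" and "x \<in> V"
  shows "finite {es. path_to r y E x es} \<and>
         real (card {es. path_to r y E x es}) \<le> A ^ card (V - {y}) * B ^ card E"
  using assms(4-)
proof (induction "card V" arbitrary: V E x rule: less_induct)
  case less
  show ?case
  proof (cases "x = y")
    case True
    have "{es. path_to r y E x es} = {[]}"
    proof -
      have "path_to r y E x es \<longleftrightarrow> es = []" for es
        using True by (cases es) auto
      then show ?thesis by auto
    qed
    moreover have "1 * 1 \<le> A ^ card (V - {y}) * B ^ card E"
      using assms by (intro mult_mono one_le_power) auto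
    ultimately show ?thesis by simp
  next
    case False
    define I where "I = {e \<in> E. x \<in> r e}"
    define E' where "E' = {e \<in> E. x \<notin> r e}"
    \<comment> \<open>One bound serves all continuations: it does not depend on the vertex reached
      by the first edge.\<close>
    define M where "M = A ^ card (V - {x} - {y}) * B ^ card E'"
    have fin: "finite I" "finite E'" using less.prems by (auto simp: I_def E'_def)
    have sub: "finite {es. path_to r y E x (e # es)} \<and>
               real (card {es. path_to r y E x (e # es)}) \<le> M" if e: "e \<in> I" for e
    proof -
      have "card (r e) = 2" "r e \<subseteq> V" "x \<in> r e" "e \<in> E" using less.prems e by (auto simp: I_def)
      then obtain z where z: "r e = {x, z}" "z \<noteq> x"
        by (elim card_2_otherE)
      have "finite {es. path_to r y E' z es} \<and> real (card {es. path_to r y E' z es}) \<le> M"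
        unfolding M_def
      proof (rule less.hyps)
        show "card (V - {x}) < card V" using less.prems by (meson card_Diff1_less)
        show "z \<in> V - {x}" using z \<open>r e \<subseteq> V\<close> by auto
        show "r f \<subseteq> V - {x} \<and> card (r f) = 2" if "f \<in> E'" for f
          using that less.prems(3)[of f] by (auto simp: E'_def)
      qed (use less.prems fin in auto)
      moreover have "{es. path_to r y E x (e # es)} = {es. path_to r y E' z es}"
        using z \<open>e \<in> E\<close> False by (auto simp: E'_def doubleton_eq_iff)
      ultimately show ?thesis by simp
    qed
    have eq: "{es. path_to r y E x es} = {e # es | e es. e \<in> I \<and> path_to r y E x (e # es)}"
    proof -
      have "path_to r y E x l \<longleftrightarrow> (\<exists>e es. l = e # es \<and> e \<in> I \<and> path_to r y E x (e # es))" for l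
        using False by (cases l) (auto simp: I_def)
      then show ?thesis by auto
    qed
    have "real (card {es. path_to r y E x es}) \<le> real (card I) * M"
      unfolding eq using fin sub by (intro card_Cons_le(2)) auto
    \<comment> \<open>The \<open>card I\<close> choices at \<open>x\<close> are paid for by one
      \<open>A\<close> for the vertex \<open>x\<close> and one \<open>B\<close> for each edge at
      it.\<close>
    also have "\<dots> \<le> (A * B ^ card I) * M"
      using assms by (intro mult_right_mono dAB) (auto simp: M_def)
    also have "\<dots> = A ^ Suc (card (V - {x} - {y})) * B ^ (card I + card E')"
      by (simp add: M_def power_add)
    also have "Suc (card (V - {x} - {y})) = card (V - {y})"
    proof -
      have "V - {x} - {y} = (V - {y}) - {x}" by auto
      then show ?thesis using less.prems False
        by (metis DiffI card_Suc_Diff1 finite_Diff singletonD)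
    qed
    also have "card I + card E' = card E"
    proof -
      have "E = I \<union> E'" "I \<inter> E' = {}" by (auto simp: I_def E'_def)
      then show ?thesis using fin by (metis card_Un_disjoint)
    qed
    finally have "real (card {es. path_to r y E x es}) \<le> A ^ card (V - {y}) * B ^ card E" .
    moreover have "finite {es. path_to r y E x es}"
      unfolding eq using fin sub by (intro card_Cons_le(1)[of I _ M]) auto
    ultimately show ?thesis by blast
  qed
qed

text \<open>Once a vertex is left, distinctness keeps the ends of all later edges away from it, so
  these edges survive the discarding in \<open>path_to\<close>. Writing the start as
  \<open>hd (vs @ [y])\<close> also covers the empty path.\<close>

lemma path_toI:
  assumes "length es = length vs" "distinct (vs @ [y])" "set es \<subseteq> E"
    and "\<And>i. i < length vs \<Longrightarrow> r (es ! i) = {(vs @ [y]) ! i, (vs @ [y]) ! Suc i}"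
  shows "path_to r y E (hd (vs @ [y])) es"
  using assms
proof (induction es arbitrary: vs E)
  case Nil
  then show ?case by simp
next
  case (Cons e es)
  then obtain x vs' where vs: "vs = x # vs'" by (cases vs) auto
  define z where "z = hd (vs' @ [y])"
  have "(vs' @ [y]) ! 0 = z" unfolding z_def by (subst hd_conv_nth) auto
  then have re: "r e = {x, z}" using Cons.prems(4)[of 0] by (simp add: vs)
  have r: "r (es ! i) = {(vs' @ [y]) ! i, (vs' @ [y]) ! Suc i}" if "i < length vs'" for i
    using Cons.prems(4)[of "Suc i"] that by (simp add: vs)
  have "set es \<subseteq> {f \<in> E. x \<notin> r f}"
  proof
    fix f assume f: "f \<in> set es"
    then obtain i where i: "i < length vs'" "f = es ! i"
      using Cons.prems(1) by (auto simp: vs in_set_conv_nth)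
    have "r f \<subseteq> set (vs' @ [y])"
      using i by (metis Suc_less_eq empty_subsetI insert_subset length_append_singleton
          less_SucI nth_mem r)
    then show "f \<in> {f \<in> E. x \<notin> r f}" using Cons.prems f by (auto simp: vs)
  qed
  then have "path_to r y {f \<in> E. x \<notin> r f} z es"
    unfolding z_def using Cons.prems r by (intro Cons.IH) (auto simp: vs)
  then show ?case using Cons.prems re by (auto simp: vs)
qed

section \<open>Cycles through a vertex as closed paths\<close>

lemma cyclic_sequence_rotate:
  assumes "cyclic_sequence G vs es"
  shows "cyclic_sequence G (rotate j vs) (rotate j es)"
proof -
  let ?k = "length vs"
  have k: "?k \<ge> 2" "length es = ?k" using assms by (auto simp: cyclic_sequence_def)
  have "joins G (rotate j es ! i) (rotate j vs ! i) (rotate j vs ! (Suc i mod ?k))" if "i < ?k" for i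
  proof -
    have "(j + Suc i mod ?k) mod ?k = Suc ((j + i) mod ?k) mod ?k"
      by (simp add: mod_simps)
    moreover have "(j + i) mod ?k < ?k" "Suc i mod ?k < ?k" using k by (auto intro: mod_less_divisor)
    ultimately show ?thesis
      using assms that k by (simp add: cyclic_sequence_def nth_rotate)
  qed
  then show ?thesis using assms by (simp add: cyclic_sequence_def)
qed

lemma cyclic_sequence_startE:
  assumes "cyclic_sequence G vs es" "v \<in> set vs"
  obtains ws l where "cyclic_sequence G (v # ws) l" "set l = set es"
proof -
  obtain j where j: "j < length vs" "vs ! j = v"
    using assms by (auto simp: in_set_conv_nth)
  then have "rotate j vs = v # (drop (Suc j) vs @ take j vs)"
    by (simp add: rotate_drop_take Cons_nth_drop_Suc[symmetric])
  then show ?thesis using that cyclic_sequence_rotate[OF assms(1), of j] by (metis set_rotate)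
qed

text \<open>The start \<open>v\<close> is kept: with \<open>k\<close> vertices, position
  \<open>i\<close> of the reversal holds the old vertex \<open>-i\<close> modulo \<open>k\<close>
  and the old edge \<open>k - 1 - i\<close>, traversed backwards.\<close>

lemma cyclic_sequence_reverse:
  assumes "cyclic_sequence G (v # vs) es"
  shows "cyclic_sequence G (v # rev vs) (rev es)"
proof -
  let ?k = "Suc (length vs)"
  have k: "?k \<ge> 2" "length es = ?k" using assms by (auto simp: cyclic_sequence_def)
  have nth_rev': "(v # rev vs) ! i = (v # vs) ! ((?k - i) mod ?k)" if "i < ?k" for i
  proof (cases i)
    case (Suc i')
    then show ?thesis using that by (simp add: rev_nth nth_Cons')
  qed simp
  have "joins G (rev es ! i) ((v # rev vs) ! i) ((v # rev vs) ! (Suc i mod ?k))" if "i < ?k" for i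
  proof -
    define j where "j = ?k - Suc i"
    have j: "j < ?k" "rev es ! i = es ! j" using that k by (auto simp: j_def rev_nth)
    have "(v # rev vs) ! i = (v # vs) ! (Suc j mod ?k)"
    proof -
      have "?k - i = Suc j" using that by (auto simp: j_def)
      then show ?thesis using nth_rev'[OF that] by simp
    qed
    moreover have "(v # rev vs) ! (Suc i mod ?k) = (v # vs) ! j"
    proof (cases "Suc i = ?k")
      case True
      then show ?thesis by (simp add: j_def)
    next
      case False
      then have "Suc i < ?k" using that by simp
      then show ?thesis using nth_rev'[of "Suc i"] by (simp add: j_def)
    qed
    moreover have "joins G (es ! j) ((v # vs) ! j) ((v # vs) ! (Suc j mod ?k))"
      using assms j by (auto simp: cyclic_sequence_def)
    ultimately show ?thesis by (simp add: joins_def insert_commute j)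
  qed
  then show ?thesis using assms by (simp add: cyclic_sequence_def)
qed

text \<open>The first edge is split off because \<open>path_to\<close> stops at once when started at
  its target. Only \<open>e\<close> is removed, not every edge at \<open>v\<close>, since the last
  edge has to return to \<open>v\<close>; keeping \<open>e\<close> would allow going straight back
  along it.\<close>

definition closed_paths :: "('v, 'e) multigraph_data \<Rightarrow> 'v \<Rightarrow> 'e list set" where
  "closed_paths G v = {e # es | e es. e \<in> {e \<in> edges G. v \<in> ends G e} \<and>
     (\<exists>z. ends G e = {v, z} \<and> path_to (ends G) v (edges G - {e}) z es)}"

lemma cyclic_sequence_in_closed_paths:
  assumes "cyclic_sequence G (v # vs) es"
  shows "es \<in> closed_paths G v"
proof -
  have k: "vs \<noteq> []" "length es = Suc (length vs)" "distinct (v # vs)" "distinct es"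
    using assms by (auto simp: cyclic_sequence_def)
  then obtain e es' where es: "es = e # es'" by (cases es) auto
  have j: "joins G (es ! i) ((v # vs) ! i) ((v # vs) ! (Suc i mod Suc (length vs)))"
    if "i < Suc (length vs)" for i
    using assms that by (auto simp: cyclic_sequence_def)
  have e: "joins G e v (hd vs)" using j[of 0] k by (simp add: es hd_conv_nth)
  have "path_to (ends G) v (edges G - {e}) (hd (vs @ [v])) es'"
  proof (rule path_toI)
    show "set es' \<subseteq> edges G - {e}"
    proof
      fix f assume f: "f \<in> set es'"
      then obtain i where "i < length vs" "f = es ! Suc i"
        using k by (auto simp: es in_set_conv_nth)
      then show "f \<in> edges G - {e}" using j[of "Suc i"] f k by (auto simp: joins_def es)
    qed
    show "ends G (es' ! i) = {(vs @ [v]) ! i, (vs @ [v]) ! Suc i}" if "i < length vs" for i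
    proof -
      have "joins G (es' ! i) (vs ! i) ((v # vs) ! (Suc (Suc i) mod Suc (length vs)))"
        using j[of "Suc i"] that by (simp add: es)
      \<comment> \<open>The case split isolates the last edge, whose end index wraps around to 0,
        that is, to \<open>v\<close>.\<close>
      then show ?thesis
        using that by (cases "Suc i = length vs") (simp_all add: joins_def nth_append)
    qed
  qed (use k es in auto)
  then show ?thesis using e k by (auto simp: closed_paths_def es joins_def)
qed

text \<open>The two traversals are an edge list and its reverse; they differ because the first and
  last edge of a cycle are distinct. Edge lists are essential here: on two parallel edges both
  directions visit the same vertex sequence.\<close>

lemma cycle_two_closed_paths:
  assumes "c \<in> cycles G" "v \<in> fst c"
  obtains l l' where "l \<in> closed_paths G v" "l' \<in> closed_paths G v" "l \<noteq> l'"
    "set l = snd c" "set l' = snd c"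
proof -
  obtain vs es where c: "c = (set vs, set es)" "cyclic_sequence G vs es"
    using assms by (auto simp: cycles_def)
  then obtain ws l where cy: "cyclic_sequence G (v # ws) l" and l: "set l = snd c"
    using assms by (auto elim: cyclic_sequence_startE)
  have "l \<noteq> rev l"
  proof -
    have l: "length l \<ge> 2" "distinct l" using cy by (auto simp: cyclic_sequence_def)
    then have "l ! 0 \<noteq> l ! (length l - 1)" by (subst nth_eq_iff_index_eq) auto
    moreover have "rev l ! 0 = l ! (length l - 1)" using l by (subst rev_nth) auto
    ultimately show ?thesis by metis
  qed
  moreover have "rev l \<in> closed_paths G v"
    using cyclic_sequence_reverse[OF cy] by (rule cyclic_sequence_in_closed_paths)
  ultimately show ?thesis
    using that[of l "rev l"] cyclic_sequence_in_closed_paths[OF cy] l by simp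
qed

text \<open>Each vertex is an end of the edge leaving it. The purpose is that a cycle is determined
  by its edge set.\<close>

lemma cycle_verts:
  assumes "c \<in> cycles G"
  shows "fst c = \<Union> (ends G ` snd c)"
proof -
  obtain vs es where c: "c = (set vs, set es)" "cyclic_sequence G vs es"
    using assms by (auto simp: cycles_def)
  have k: "length vs = length es" "length vs > 0"
    and j: "\<And>i. i < length vs \<Longrightarrow> ends G (es ! i) = {vs ! i, vs ! (Suc i mod length vs)}"
    using c by (auto simp: cyclic_sequence_def joins_def)
  have "set vs = (\<Union>i<length vs. {vs ! i, vs ! (Suc i mod length vs)})"
  proof -
    have "vs ! (Suc i mod length vs) \<in> set vs" for i using k(2) by simp
    then show ?thesis by (auto simp: set_conv_nth)
  qed
  also have "\<dots> = (\<Union>i<length vs. ends G (es ! i))"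
    using j by auto
  also have "\<dots> = \<Union> (ends G ` set es)"
    by (auto simp: set_conv_nth k)
  finally show ?thesis by (simp add: c)
qed

context multigraph
begin

text \<open>After the choice of the first edge, \<open>path_count\<close> bounds the ways back; the
  target \<open>v\<close> and the edge already used account for the two exponents dropping by
  1.\<close>

lemma closed_paths_count:
  fixes A B :: real
  assumes "1 \<le> A" "1 \<le> B" "\<And>d::nat. real d \<le> A * B ^ d" and "v \<in> verts G"
  shows "finite (closed_paths G v)"
    and "real (card (closed_paths G v)) \<le>
           real (degree G v) * (A ^ (card (verts G) - 1) * B ^ (card (edges G) - 1))"
proof -
  define M where "M = A ^ (card (verts G) - 1) * B ^ (card (edges G) - 1)"
  let ?P = "\<lambda>e es. \<exists>z. ends G e = {v, z} \<and> path_to (ends G) v (edges G - {e}) z es"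
  have sub: "finite {es. ?P e es} \<and> real (card {es. ?P e es}) \<le> M"
    if e: "e \<in> edges G" "v \<in> ends G e" for e
  proof -
    obtain z where z: "ends G e = {v, z}" "z \<noteq> v"
      using card_ends[OF e(1)] e(2) by (rule card_2_otherE)
    have "{es. ?P e es} = {es. path_to (ends G) v (edges G - {e}) z es}"
      using z by (auto simp: doubleton_eq_iff)
    moreover have "finite {es. path_to (ends G) v (edges G - {e}) z es} \<and>
      real (card {es. path_to (ends G) v (edges G - {e}) z es}) \<le>
        A ^ card (verts G - {v}) * B ^ card (edges G - {e})"
    proof (rule path_count)
      show "z \<in> verts G" using ends_subset[OF e(1)] z by simp
    qed (use assms finite_verts finite_edges ends_subset card_ends in auto)
    ultimately show ?thesis
      using e assms(4) finite_verts finite_edges by (simp add: M_def)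
  qed
  show "finite (closed_paths G v)"
    unfolding closed_paths_def using sub finite_edges by (intro card_Cons_le(1)[where M = M]) auto
  show "real (card (closed_paths G v)) \<le> real (degree G v) * M"
    unfolding closed_paths_def degree_def using sub finite_edges by (intro card_Cons_le(2)) auto
qed

text \<open>Double counting: at least two closed paths carry the edge set of a given cycle, and
  these classes are disjoint because different cycles have different edge sets.\<close>

lemma card_cycles_through:
  assumes "finite (closed_paths G v)"
  shows "2 * card {c \<in> cycles G. v \<in> fst c} \<le> card (closed_paths G v)"
proof -
  let ?C = "{c \<in> cycles G. v \<in> fst c}"
  let ?L = "\<lambda>c. {l \<in> closed_paths G v. set l = snd c}"
  have two: "2 \<le> card (?L c)" if c: "c \<in> ?C" for c
  proof -
    have "c \<in> cycles G" "v \<in> fst c" using c by auto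
    then obtain l l' where l: "l \<in> closed_paths G v" "l' \<in> closed_paths G v" "l \<noteq> l'"
      "set l = snd c" "set l' = snd c"
      by (rule cycle_two_closed_paths)
    then have "card {l, l'} = 2" by simp
    moreover have "card {l, l'} \<le> card (?L c)" using assms l by (intro card_mono) auto
    ultimately show ?thesis by simp
  qed
  have "2 * card ?C = (\<Sum>c\<in>?C. 2)" by simp
  also have "\<dots> \<le> (\<Sum>c\<in>?C. card (?L c))" using two by (intro sum_mono) auto
  also have "\<dots> = card (\<Union>c\<in>?C. ?L c)"
  proof (rule card_UN_disjoint[symmetric])
    show "\<forall>c\<in>?C. \<forall>c'\<in>?C. c \<noteq> c' \<longrightarrow> ?L c \<inter> ?L c' = {}"
    proof (intro ballI impI)
      fix c c' assume "c \<in> ?C" "c' \<in> ?C" "c \<noteq> c'"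
      then have "snd c \<noteq> snd c'" using cycle_verts[of _ G] by (metis (no_types, lifting) mem_Collect_eq prod_eqI)
      then show "?L c \<inter> ?L c' = {}" by auto
    qed
  qed (use assms finite_cycles in auto)
  also have "\<dots> \<le> card (closed_paths G v)" using assms by (intro card_mono) auto
  finally show ?thesis .
qed

text \<open>The first and last edge of a traversal from \<open>v\<close> are two distinct edges at
  \<open>v\<close>.\<close>

lemma no_cycles_through:
  assumes "degree G v \<le> 1"
  shows "{c \<in> cycles G. v \<in> fst c} = {}"
proof (rule ccontr)
  assume "{c \<in> cycles G. v \<in> fst c} \<noteq> {}"
  then obtain vs es where c: "cyclic_sequence G vs es" "v \<in> set vs"
    by (auto simp: cycles_def)
  then obtain ws l where cy: "cyclic_sequence G (v # ws) l"
    by (rule cyclic_sequence_startE)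
  let ?k = "length ws"
  have k: "?k \<ge> 1" "length l = Suc ?k" "distinct l" using cy by (auto simp: cyclic_sequence_def)
  have jn: "joins G (l ! i) ((v # ws) ! i) ((v # ws) ! (Suc i mod Suc ?k))" if "i < Suc ?k" for i
    using cy that by (auto simp: cyclic_sequence_def)
  have "{l ! 0, l ! ?k} \<subseteq> {e \<in> edges G. v \<in> ends G e}"
    using jn[of 0] jn[of ?k] by (auto simp: joins_def)
  then have "card {l ! 0, l ! ?k} \<le> degree G v"
    unfolding degree_def using finite_edges by (intro card_mono) auto
  moreover have "l ! 0 \<noteq> l ! ?k" using k by (subst nth_eq_iff_index_eq) auto
  ultimately show False using assms by simp
qed

end

section \<open>Vertex deletion and the induction\<close>

definition delete_vertex :: "('v, 'e) multigraph_data \<Rightarrow> 'v \<Rightarrow> ('v, 'e) multigraph_data" where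
  "delete_vertex G v =
     G\<lparr>verts := verts G - {v}, edges := {e \<in> edges G. v \<notin> ends G e}\<rparr>"

lemma delete_vertex_sel [simp]:
  "verts (delete_vertex G v) = verts G - {v}"
  "edges (delete_vertex G v) = {e \<in> edges G. v \<notin> ends G e}"
  "ends (delete_vertex G v) = ends G"
  by (simp_all add: delete_vertex_def)

lemma cycles_delete_vertex:
  "cycles (delete_vertex G v) = {c \<in> cycles G. v \<notin> fst c}"
proof -
  have *: "cyclic_sequence (delete_vertex G v) vs es \<longleftrightarrow> cyclic_sequence G vs es \<and> v \<notin> set vs" for vs es
  proof -
    have "Suc i mod length vs < length vs" if "i < length vs" for i
      using that by (intro mod_less_divisor) auto
    then have "v \<notin> set vs \<Longrightarrow> i < length vs \<Longrightarrow> v \<noteq> vs ! i \<and> v \<noteq> vs ! (Suc i mod length vs)" for i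
      by (metis nth_mem)
    then show ?thesis by (auto simp: cyclic_sequence_def joins_def)
  qed
  show ?thesis unfolding cycles_def * by (auto, blast)
qed

lemma multigraph_delete_vertex: "multigraph G \<Longrightarrow> multigraph (delete_vertex G v)"
  unfolding multigraph_def by auto

lemma degree_delete_vertex_le:
  assumes "multigraph G"
  shows "degree (delete_vertex G v) u \<le> degree G u"
  unfolding degree_def using multigraph.finite_edges[OF assms] by (intro card_mono) auto

text \<open>A fixed \<open>D\<close> replaces the maximum degree, which may fall to 0 under deletion
  and would then spoil the strict inequality. The last condition on \<open>A\<close> and
  \<open>B\<close> says \<open>2 * A * B + 3 \<le> 3 * A * B ^ 2\<close>, the comparison needed when
  a vertex of degree 2 is deleted.\<close>

theorem num_cycles_less:
  fixes A B D :: real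
  assumes AB: "1 \<le> A" "1 \<le> B" "\<And>d::nat. real d \<le> A * B ^ d" "3 \<le> A * B * (3 * B - 2)"
    and "multigraph G" "verts G \<noteq> {}" "1 \<le> D" "\<And>v. v \<in> verts G \<Longrightarrow> real (degree G v) \<le> D"
  shows "real (num_cycles G) < 3 / 4 * D * (A ^ (card (verts G) - 1) * B ^ card (edges G))"
  using assms(5-)
proof (induction "card (verts G)" arbitrary: G rule: less_induct)
  case less
  interpret multigraph G by fact
  obtain v where v: "v \<in> verts G" using less.prems by auto
  show ?case
  proof (cases "verts G = {v}")
    case True
    have "cycles G = {}"
    proof -
      have "\<not> cyclic_sequence G vs es" for vs es
      proof
        assume "cyclic_sequence G vs es"
        then have "2 \<le> card (set vs)" "set vs \<subseteq> {v}"
          using True by (auto simp: cyclic_sequence_def distinct_card)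
        then show False using card_mono[of "{v}" "set vs"] by simp
      qed
      then show ?thesis by (auto simp: cycles_def)
    qed
    moreover have "0 < 3 / 4 * D * (A ^ (card (verts G) - 1) * B ^ card (edges G))"
      using less.prems AB by (intro mult_pos_pos zero_less_power) auto
    ultimately show ?thesis by (simp add: num_cycles_def)
  next
    case False
    define H where "H = delete_vertex G v"
    define k where "k = card (verts G) - 2"
    define d where "d = degree G v"
    define h where "h = card (edges H)"
    have nH: "verts H \<noteq> {}" using False v by (auto simp: H_def)
    have "card (verts H) > 0" using nH finite_verts by (auto simp: H_def card_gt_0_iff)
    then have cG: "card (verts G) = k + 2" and cH: "card (verts H) = k + 1"
      using v finite_verts by (auto simp: H_def k_def)
    have m: "card (edges G) = d + h"
    proof -
      have "edges G = {e \<in> edges G. v \<in> ends G e} \<union> edges H"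
        by (auto simp: H_def)
      moreover have "card ({e \<in> edges G. v \<in> ends G e} \<union> edges H) = d + h"
        unfolding d_def degree_def h_def
        by (intro card_Un_disjoint) (auto simp: H_def finite_edges)
      ultimately show ?thesis by simp
    qed
    have IH: "real (num_cycles H) < 3 / 4 * D * (A ^ k * B ^ h)"
    proof -
      have "real (num_cycles H) < 3 / 4 * D * (A ^ (card (verts H) - 1) * B ^ card (edges H))"
      proof (rule less.hyps)
        show "real (degree H u) \<le> D" if "u \<in> verts H" for u
          using less.prems(4)[of u] that degree_delete_vertex_le[OF less.prems(1), of v u]
          by (auto simp: H_def)
        show "multigraph H" using less.prems(1) by (simp add: H_def multigraph_delete_vertex)
      qed (use cG cH nH less.prems(3) in auto)
      then show ?thesis by (simp add: cH h_def)
    qed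
    have split: "num_cycles G = card {c \<in> cycles G. v \<in> fst c} + num_cycles H"
    proof -
      have "cycles G = {c \<in> cycles G. v \<in> fst c} \<union> cycles H"
        by (auto simp: H_def cycles_delete_vertex)
      moreover have "card ({c \<in> cycles G. v \<in> fst c} \<union> cycles H)
          = card {c \<in> cycles G. v \<in> fst c} + card (cycles H)"
        using finite_cycles by (intro card_Un_disjoint) (auto simp: H_def cycles_delete_vertex)
      ultimately show ?thesis by (simp add: num_cycles_def)
    qed
    \<comment> \<open>\<open>T\<close> is the factor in the bound for \<open>H\<close>; passing to
      \<open>G\<close> multiplies it by \<open>A * B ^ d\<close>.\<close>
    define T where "T = A ^ k * B ^ h"
    have T: "0 < T" using AB by (auto simp: T_def)
    have total: "A ^ (card (verts G) - 1) * B ^ card (edges G) = A * B ^ d * T"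
      by (simp add: cG m T_def power_add)
    show ?thesis
    proof (cases "d \<le> 1")
      case True
      then have "num_cycles G = num_cycles H" 
        using no_cycles_through[of v] split by (simp only: d_def card.empty)
      moreover have "1 * 1 \<le> A * B ^ d" using AB by (intro mult_mono one_le_power) auto
      then have "T \<le> A * B ^ d * T" using T by simp
      then have "3 / 4 * D * T \<le> 3 / 4 * D * (A * B ^ d * T)"
        using less.prems by (intro mult_left_mono) auto
      ultimately show ?thesis using IH unfolding total by (simp add: T_def)
    next
      case False
      then obtain q where q: "d = q + 2" by (metis add.commute le_Suc_ex not_less_eq_eq Suc_1 One_nat_def)
      have c: "2 * real (card {c \<in> cycles G. v \<in> fst c}) \<le> real d * (A * B ^ (q + 1) * T)"
      proof -
        have "2 * real (card {c \<in> cycles G. v \<in> fst c}) \<le> real (card (closed_paths G v))"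
          using card_cycles_through[OF closed_paths_count(1)[OF AB(1-3) v]] by linarith
        also have "\<dots> \<le> real d * (A ^ (card (verts G) - 1) * B ^ (card (edges G) - 1))"
          unfolding d_def by (rule closed_paths_count(2)[OF AB(1-3) v])
        also have "A ^ (card (verts G) - 1) * B ^ (card (edges G) - 1) = A * B ^ (q + 1) * T"
          by (simp add: cG m T_def q power_add)
        finally show ?thesis .
      qed
      also have "\<dots> \<le> D * (A * B ^ (q + 1) * T)"
        using less.prems(4)[OF v] AB T by (intro mult_right_mono) (auto simp: d_def)
      finally have "real (num_cycles G) < D / 2 * (A * B ^ (q + 1) * T) + 3 / 4 * D * T"
        using IH by (simp add: split T_def)
      also have "\<dots> = D * T / 4 * (2 * (A * B ^ (q + 1)) + 3)" by (simp add: field_simps)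
      also have "\<dots> \<le> D * T / 4 * (3 * (A * B ^ d))"
      proof (intro mult_left_mono)
        \<comment> \<open>\<open>B ^ q \<ge> 1\<close> reduces every degree \<open>q + 2\<close> to
          the case of degree 2.\<close>
        have "3 * 1 \<le> A * B * (3 * B - 2) * B ^ q"
          using AB by (intro mult_mono one_le_power) auto
        then show "2 * (A * B ^ (q + 1)) + 3 \<le> 3 * (A * B ^ d)"
          by (simp add: q algebra_simps power2_eq_square)
      qed (use T less.prems in auto)
      also have "\<dots> = 3 / 4 * D * (A * B ^ d * T)" by simp
      finally show ?thesis unfolding total .
    qed
  qed
qed

section \<open>Constants for part (i)\<close>

text \<open>Equality holds at 3. From there on \<open>(d + 1) ^ 3 \<le> 3 * d ^ 3\<close>, as
  \<open>d ^ 3\<close> dominates both \<open>9 * d\<close> and \<open>3 * d ^ 2\<close>; smaller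
  \<open>d\<close> are checked directly.\<close>

lemma power3_le_3_power: "d ^ 3 \<le> (3::nat) ^ d"
proof -
  have "d ^ 3 \<le> (3::nat) ^ d" if "3 \<le> d"
    using that
  proof (induction d rule: dec_induct)
    case (step d)
    have "9 \<le> d * d" using mult_le_mono[OF step(1) step(1)] by simp
    then have "9 * d \<le> d * d * d" by (rule mult_le_mono1)
    moreover have "3 * (d * d) \<le> d * (d * d)" using step(1) by (rule mult_le_mono1)
    ultimately have "1 + 3 * d + 3 * (d * d) \<le> 2 * (d * d * d)" using step(1)
      unfolding mult.assoc by linarith
    then have "Suc d ^ 3 \<le> 3 * d ^ 3" by (simp add: power3_eq_cube algebra_simps)
    then show ?case using step by simp
  qed simp
  moreover have "d = 0 \<or> d = 1 \<or> d = 2" if "\<not> 3 \<le> d" using that by auto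
  ultimately show ?thesis by fastforce
qed

lemma le_root3_power: "real d \<le> root 3 3 ^ d"
proof (rule power_le_imp_le_base)
  have "real d ^ Suc 2 = real (d ^ 3)" by (simp add: numeral_3_eq_3)
  also have "\<dots> \<le> real (3 ^ d)" using power3_le_3_power by (metis of_nat_le_iff)
  also have "\<dots> = (root 3 3 ^ 3) ^ d" by (subst real_root_pow_pos2) auto
  also have "\<dots> = (root 3 3 ^ d) ^ Suc 2"
    by (metis eval_nat_numeral(3) mult.commute power_mult)
  finally show "real d ^ Suc 2 \<le> (root 3 3 ^ d) ^ Suc 2" .
qed simp

lemma root3_bound: "3 \<le> root 3 3 * (3 * root 3 3 - 2)"
proof -
  \<comment> \<open>The cube of 7/5 is 343/125, below 3, while 7/5 is still large enough: 7/5 * 11/5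
    = 77/25 exceeds 3.\<close>
  have "7 / 5 \<le> root 3 (3::real)"
  proof (rule power_le_imp_le_base)
    have "root 3 (3::real) ^ Suc 2 = 3"
      using real_root_pow_pos2[of 3 "3::real"] by (simp add: numeral_3_eq_3 numeral_2_eq_2)
    then show "(7 / 5) ^ Suc 2 \<le> root 3 (3::real) ^ Suc 2"
      by (simp add: numeral_2_eq_2)
  qed simp
  then have "(7 / 5) * (3 * (7 / 5) - 2) \<le> root 3 3 * (3 * root 3 3 - 2)"
    by (intro mult_mono) auto
  then show ?thesis by simp
qed

section \<open>Constants for part (ii)\<close>

lemma succ_ratio_power_le_3:
  fixes s :: nat
  assumes "s > 0"
  shows "((real s + 1) / real s) ^ s \<le> 3"
proof -
  have "(1 + 1 / real s) ^ s \<le> exp (1 / real s) ^ s"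
    by (intro power_mono exp_ge_add_one_self) auto
  also have "\<dots> = exp 1" using assms by (simp flip: exp_of_nat_mult)
  finally have "(1 + 1 / real s) ^ s \<le> exp 1" .
  moreover have "1 + 1 / real s = (real s + 1) / real s" using assms by (simp add: field_simps)
  ultimately show ?thesis using exp_le by simp
qed

context
  fixes s :: nat and A B :: real
  assumes s: "s \<ge> 3"
  defines "B \<equiv> (real s + 1) / real s"
  defines "A \<equiv> real s / B ^ s"
begin

text \<open>Since \<open>B ^ s \<le> 3 \<le> s\<close>, the quotient \<open>A\<close> is at least
  1.\<close>

lemma interpolation_ge_1: "1 \<le> A" "1 \<le> B"
proof -
  show "1 \<le> B" using s by (simp add: B_def)
  then show "1 \<le> A" using succ_ratio_power_le_3[of s] s by (simp add: A_def B_def)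
qed

text \<open>Starting from equality at \<open>s\<close>, induction runs in both directions. One step
  multiplies the right side by \<open>B\<close>, and \<open>d * B \<le> d + 1\<close> holds for
  \<open>d \<le> s\<close> and is reversed for \<open>d \<ge> s\<close>.\<close>

lemma interpolation_ge: "real d \<le> A * B ^ d"
proof (cases "d \<le> s")
  case True
  have B: "B > 0" using interpolation_ge_1 by simp
  show ?thesis using True
  proof (induction d rule: inc_induct)
    case base
    then show ?case using B by (simp add: A_def)
  next
    case (step d)
    have "real d * B \<le> real (Suc d)" using s step by (simp add: B_def field_simps)
    also have "\<dots> \<le> A * B ^ d * B" using step by (simp add: mult_ac)
    finally show ?case using B by simp
  qed
next
  case False
  then have "s \<le> d" by simp
  have B: "B > 0" using interpolation_ge_1 by simp
  show ?thesis using \<open>s \<le> d\<close>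
  proof (induction d rule: dec_induct)
    case base
    then show ?case using B by (simp add: A_def)
  next
    case (step d)
    have "real (Suc d) \<le> real d * B" using s step by (simp add: B_def field_simps)
    also have "\<dots> \<le> A * B ^ d * B" using step B by (intro mult_right_mono) auto
    finally show ?case by (simp add: mult_ac)
  qed
qed

text \<open>Substituting \<open>A\<close> and \<open>B\<close> turns the claim into
  \<open>B ^ (s - 1) \<le> 1 + s / 3\<close>. For \<open>s \<ge> 6\<close> the right side is at
  least 3, which bounds \<open>B ^ s\<close>; the values 3, 4, 5 are computed.\<close>

lemma interpolation_step: "3 \<le> A * B * (3 * B - 2)"
proof -
  have B: "B > 0" using interpolation_ge_1 by simp
  have *: "B ^ (s - 1) \<le> 1 + real s / 3"
  proof (cases "s \<ge> 6")
    case True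
    have "B ^ (s - 1) \<le> B ^ s" using interpolation_ge_1 by (intro power_increasing) auto
    also have "\<dots> \<le> 3" using succ_ratio_power_le_3[of s] s by (simp add: B_def)
    finally show ?thesis using True by simp
  next
    case False
    then have "s = 3 \<or> s = 4 \<or> s = 5" using s by auto
    then show ?thesis by (auto simp: B_def power_divide)
  qed
  have "B ^ s = B ^ (s - 1) * B" using s by (metis power_minus_mult not_numeral_le_zero not_gr_zero)
  then have "A * B = real s / B ^ (s - 1)" using B by (simp add: A_def)
  moreover have "real s * (3 * B - 2) = real s + 3"
    using s by (simp add: B_def field_simps)
  ultimately have "A * B * (3 * B - 2) = (real s + 3) / B ^ (s - 1)" by simp
  also have "\<dots> \<ge> 3" using * B by (simp add: field_simps)
  finally show ?thesis .
qed

text \<open>As \<open>s + 1 = s * B\<close>, the base on the left is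
  \<open>s * B powr \<alpha>\<close>. With \<open>\<alpha> * N = m - s * N\<close>, its
  \<open>N\<close>-th power is \<open>s ^ N * B ^ m / (B ^ s) ^ N\<close>.\<close>

lemma interpolation_eq:
  assumes "N > 0" "real m = (real s + \<alpha>) * real N"
  shows "(real s powr (1 - \<alpha>) * (real s + 1) powr \<alpha>) ^ N = A ^ N * B ^ m"
proof -
  have B: "B > 0" using interpolation_ge_1 by simp
  have "(real s + 1) powr \<alpha> = real s powr \<alpha> * B powr \<alpha>"
    using s by (simp add: B_def flip: powr_mult)
  then have "real s powr (1 - \<alpha>) * (real s + 1) powr \<alpha> = real s * B powr \<alpha>"
    using s by (simp add: mult.assoc[symmetric] flip: powr_add)
  then have "(real s powr (1 - \<alpha>) * (real s + 1) powr \<alpha>) ^ N = real s ^ N * B powr (\<alpha> * real N)"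
    using B by (simp add: power_mult_distrib powr_powr flip: powr_realpow)
  also have "\<alpha> * real N = real m - real (s * N)" using assms by (simp add: algebra_simps)
  also have "B powr (real m - real (s * N)) = B ^ m / (B ^ s) ^ N"
    using B by (simp add: powr_diff powr_realpow power_mult flip: of_nat_mult)
  finally show ?thesis by (simp add: A_def power_divide)
qed

end

section \<open>Specialisation to the maximum degree and the two choices of constants\<close>

theorem theorem3p1:
  fixes G :: "('v, 'e) multigraph_data" and n m :: nat
  assumes "multigraph G"
    and "card (verts G) = n" and "n \<ge> 2"
    and "card (edges G) = m" and "m \<ge> 1"
  shows "(real m / (real n - 1) < 3 \<longrightarrow>
           real (num_cycles G) < 3 / 4 * real (max_degree G) * root 3 3 ^ m) \<and>
         (real m / (real n - 1) \<ge> 3 \<longrightarrow>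
          (let s = real_of_int \<lfloor>real m / (real n - 1)\<rfloor>;
               \<alpha> = real m / (real n - 1) - s
           in real (num_cycles G)
                < 3 / 4 * real (max_degree G) * (s powr (1 - \<alpha>) * (s + 1) powr \<alpha>) ^ (n - 1) \<and>
              3 / 4 * real (max_degree G) * (s powr (1 - \<alpha>) * (s + 1) powr \<alpha>) ^ (n - 1)
                = 3 / 4 * real (max_degree G) *
                    ((s powr (1 - \<alpha>) * (s + 1) powr \<alpha>) powr (1 / (s + \<alpha>))) ^ m))"
proof -
  interpret multigraph G by fact
  have ne: "verts G \<noteq> {}" using assms by auto
  have deg: "degree G v \<le> max_degree G" if "v \<in> verts G" for v
    unfolding max_degree_def using that finite_verts by (intro Max_ge) auto
  have D: "1 \<le> max_degree G"
  proof -
    obtain e where e: "e \<in> edges G" using assms by (metis card.empty all_not_in_conv not_one_le_zero)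
    then obtain v where v: "v \<in> ends G e" using card_ends[OF e] by (auto simp: card_2_iff)
    have "1 \<le> degree G v" unfolding degree_def
      using e v finite_edges by (metis (no_types, lifting) One_nat_def Suc_leI card_gt_0_iff empty_iff finite_subset mem_Collect_eq subsetI)
    also have "\<dots> \<le> max_degree G" using deg ends_subset e v by blast
    finally show ?thesis .
  qed
  have bound: "real (num_cycles G) < 3 / 4 * real (max_degree G) * (A ^ (n - 1) * B ^ m)"
    if "1 \<le> A" "1 \<le> B" "\<And>d::nat. real d \<le> A * B ^ d" "3 \<le> A * B * (3 * B - 2)" for A B :: real
    using num_cycles_less[OF that assms(1) ne, of "real (max_degree G)"] deg D assms by simp
  have N: "real n - 1 = real (n - 1)" "n - 1 > 0" using assms by auto
  show ?thesis
  proof (intro conjI impI)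
    show "real (num_cycles G) < 3 / 4 * real (max_degree G) * root 3 3 ^ m"
      using bound[of 1 "root 3 3"] le_root3_power root3_bound by simp
  next
    assume ge: "real m / (real n - 1) \<ge> 3"
    \<comment> \<open>The floor is at least 3, so \<open>nat\<close> preserves its value and
      \<open>s\<close> can serve as an exponent.\<close>
    define s where "s = nat \<lfloor>real m / (real n - 1)\<rfloor>"
    define \<alpha> where "\<alpha> = real m / (real n - 1) - real s"
    have s: "s \<ge> 3" "real_of_int \<lfloor>real m / (real n - 1)\<rfloor> = real s"
      using ge by (auto simp: s_def le_nat_iff le_floor_iff)
    have sa: "real s + \<alpha> = real m / (real n - 1)" by (simp add: \<alpha>_def)
    have m: "real m = (real s + \<alpha>) * real (n - 1)" unfolding sa using N by simp
    define X where "X = real s powr (1 - \<alpha>) * (real s + 1) powr \<alpha>"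
    have "X > 0" using s by (simp add: X_def)
    have "real (num_cycles G) < 3 / 4 * real (max_degree G) * X ^ (n - 1)"
      unfolding X_def interpolation_eq[OF s(1) N(2) m]
      by (rule bound[OF interpolation_ge_1[OF s(1)] interpolation_ge[OF s(1)] interpolation_step[OF s(1)]])
    \<comment> \<open>Since \<open>s + \<alpha>\<close> equals \<open>m / (n - 1)\<close>, the
      exponents \<open>m / (s + \<alpha>)\<close> and \<open>n - 1\<close> agree.\<close>
    moreover have "X ^ (n - 1) = (X powr (1 / (real s + \<alpha>))) ^ m"
    proof -
      have "(X powr (1 / (real s + \<alpha>))) ^ m = X powr (1 / (real s + \<alpha>) * real m)"
        using \<open>X > 0\<close> by (simp add: powr_powr flip: powr_realpow)
      also have "1 / (real s + \<alpha>) * real m = real (n - 1)"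
        using N assms unfolding sa by simp
      finally show ?thesis using \<open>X > 0\<close> by (simp add: powr_realpow)
    qed
    ultimately show "let s = real_of_int \<lfloor>real m / (real n - 1)\<rfloor>;
               \<alpha> = real m / (real n - 1) - s
           in real (num_cycles G)
                < 3 / 4 * real (max_degree G) * (s powr (1 - \<alpha>) * (s + 1) powr \<alpha>) ^ (n - 1) \<and>
              3 / 4 * real (max_degree G) * (s powr (1 - \<alpha>) * (s + 1) powr \<alpha>) ^ (n - 1)
                = 3 / 4 * real (max_degree G) *
                    ((s powr (1 - \<alpha>) * (s + 1) powr \<alpha>) powr (1 / (s + \<alpha>))) ^ m"
      unfolding Let_def s(2) \<alpha>_def[symmetric] X_def[symmetric] by simp
  qed
qed

end
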